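(* Let $p\ge 2$ and $n\ge\max\{4,2p\}$. Let $F_0\subseteq E(K_n)$ be an edge set with $H_{F_0}\cong P_3\cup(p-2)K_2$, and let $M\subseteq E(K_n)$ be a matching with $p$ edges. Then $$Kf(K_n-F_0)-Kf(K_n-M)=\frac{2n}{(n-1)(n-2)(n-3)}.$$
   Context: $K_n$ is the complete graph on $n$ vertices and $K_n-F$ is obtained from it by deleting the edges in $F$ (keeping all vertices). The deletion graph of an edge set $F$ is $H_F=(V(F),F)$ with $V(F)=\bigcup_{e\in F}e$. $P_3$ is the path on $3$ vertices, and $P_3\cup(p-2)K_2$ is the disjoint union of $P_3$ and $p-2$ single edges. A matching is a set of pairwise disjoint edges. For a connected graph $G$ with Laplacian $L(G)=D(G)-A(G)$, the effective resistance between distinct vertices is $R_G(x,y)=(e_x-e_y)^TL(G)^+(e_x-e_y)$ ($L(G)^+$ the Moore--Penrose inverse, $e_x$ the standard basis vector of vertex $x$), and the Kirchhoff index is $Kf(G)=\sum_{\{x,y\}}R_G(x,y)$, the sum over all unordered pairs of distinct vertices. *)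

theory Defs
  imports "HOL-Analysis.Analysis" "HOL-Library.Disjoint_Sets"
begin

text \<open>An edge is the two-element set of its endpoints.\<close>

record 'a ugraph =
  verts :: "'a set"
  edges :: "'a set set"

definition complete_graph :: "'a set \<Rightarrow> 'a ugraph" where
  "complete_graph V = \<lparr>verts = V, edges = {e. e \<subseteq> V \<and> card e = 2}\<rparr>"

definition path_graph :: "nat \<Rightarrow> nat ugraph" where
  "path_graph k = \<lparr>verts = {..<k}, edges = {{i, Suc i} |i. Suc i < k}\<rparr>"

definition disjoint_union :: "'a ugraph \<Rightarrow> 'b ugraph \<Rightarrow> ('a + 'b) ugraph" where
  "disjoint_union G H =
     \<lparr>verts = Inl ` verts G \<union> Inr ` verts H,
      edges = (\<lambda>e. Inl ` e) ` edges G \<union> (\<lambda>e. Inr ` e) ` edges H\<rparr>"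

text \<open>The disjoint union of \<open>m\<close> copies of \<open>G\<close>; the first component tells the copies apart.\<close>

definition copies :: "nat \<Rightarrow> 'a ugraph \<Rightarrow> (nat \<times> 'a) ugraph" where
  "copies m G = \<lparr>verts = {..<m} \<times> verts G, edges = {Pair i ` e |i e. i < m \<and> e \<in> edges G}\<rparr>"

definition graph_iso :: "'a ugraph \<Rightarrow> 'b ugraph \<Rightarrow> bool" where
  "graph_iso G H \<longleftrightarrow>
     (\<exists>f. bij_betw f (verts G) (verts H) \<and>
          (\<forall>x\<in>verts G. \<forall>y\<in>verts G. {x, y} \<in> edges G \<longleftrightarrow> {f x, f y} \<in> edges H))"

definition delete_edges :: "'a ugraph \<Rightarrow> 'a set set \<Rightarrow> 'a ugraph" where
  "delete_edges G F = \<lparr>verts = verts G, edges = edges G - F\<rparr>"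

definition deletion_graph :: "'a set set \<Rightarrow> 'a ugraph" where
  "deletion_graph F = \<lparr>verts = \<Union>F, edges = F\<rparr>"

definition matching_in :: "'a ugraph \<Rightarrow> 'a set set \<Rightarrow> bool" where
  "matching_in G M \<longleftrightarrow> M \<subseteq> edges G \<and> disjoint M"

text \<open>The four Penrose equations; the real Moore--Penrose inverse is their unique solution.\<close>

definition is_pinv :: "real ^ 'n ^ 'm \<Rightarrow> real ^ 'm ^ 'n \<Rightarrow> bool" where
  "is_pinv A X \<longleftrightarrow>
     A ** X ** A = A \<and> X ** A ** X = X \<and>
     transpose (A ** X) = A ** X \<and> transpose (X ** A) = X ** A"

definition pinv :: "real ^ 'n ^ 'm \<Rightarrow> real ^ 'm ^ 'n" where
  "pinv A = (THE X. is_pinv A X)"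

lemma is_pinv_unique:
  fixes A :: "real ^ 'n ^ 'm"
  assumes "is_pinv A X" "is_pinv A Y"
  shows "X = Y"
proof -
  have X: "A ** X ** A = A" "X ** A ** X = X"
      "transpose (A ** X) = A ** X" "transpose (X ** A) = X ** A"
    and Y: "A ** Y ** A = A" "Y ** A ** Y = Y"
      "transpose (A ** Y) = A ** Y" "transpose (Y ** A) = Y ** A"
    using assms unfolding is_pinv_def by auto
  have "A ** X = (A ** Y ** A) ** X" using Y(1) by simp
  also have "\<dots> = transpose (A ** Y) ** transpose (A ** X)"
    using X(3) Y(3) by (simp add: matrix_mul_assoc)
  also have "\<dots> = transpose (A ** X ** A ** Y)"
    by (simp add: matrix_transpose_mul matrix_mul_assoc)
  also have "\<dots> = A ** Y" using X(1) Y(3) by simp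
  finally have 1: "A ** X = A ** Y" .
  have "X ** A = X ** (A ** Y ** A)" using Y(1) by simp
  also have "\<dots> = transpose (X ** A) ** transpose (Y ** A)"
    using X(4) Y(4) by (simp add: matrix_mul_assoc)
  also have "\<dots> = transpose (Y ** (A ** X ** A))"
    by (simp add: matrix_transpose_mul matrix_mul_assoc)
  also have "\<dots> = Y ** A" using X(1) Y(4) by simp
  finally have 2: "X ** A = Y ** A" .
  have "X = X ** (A ** X)" using X(2) by (simp add: matrix_mul_assoc)
  also have "\<dots> = (X ** A) ** Y" using 1 by (simp add: matrix_mul_assoc)
  also have "\<dots> = Y" using 2 Y(2) by simp
  finally show ?thesis .
qed

lemma pinv_eq: "is_pinv A X \<Longrightarrow> pinv A = X"
  unfolding pinv_def by (blast intro: the_equality is_pinv_unique)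

text \<open>
  Matrices are indexed by the whole vertex type. If \<open>verts G\<close> is a proper subset of it, the
  Laplacian is padded with zero rows and columns, and so is its pseudoinverse; the quantities
  below are then still those of \<open>G\<close>.
\<close>

definition adjacency_matrix :: "'v::finite ugraph \<Rightarrow> real ^ 'v ^ 'v" where
  "adjacency_matrix G = (\<chi> x y. if {x, y} \<in> edges G then 1 else 0)"

definition degree :: "'v ugraph \<Rightarrow> 'v \<Rightarrow> nat" where
  "degree G x = card {e \<in> edges G. x \<in> e}"

definition degree_matrix :: "'v::finite ugraph \<Rightarrow> real ^ 'v ^ 'v" where
  "degree_matrix G = (\<chi> x y. if x = y then real (degree G x) else 0)"

definition laplacian :: "'v::finite ugraph \<Rightarrow> real ^ 'v ^ 'v" where
  "laplacian G = degree_matrix G - adjacency_matrix G"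

definition eff_resistance :: "'v::finite ugraph \<Rightarrow> 'v \<Rightarrow> 'v \<Rightarrow> real" where
  "eff_resistance G x y =
     (axis x 1 - axis y 1) \<bullet> (pinv (laplacian G) *v (axis x 1 - axis y 1))"

lemma eff_resistance_commute:
  fixes G :: "'v::finite ugraph"
  shows "eff_resistance G x y = eff_resistance G y x"
proof -
  have neg: "axis x 1 - axis y 1 = - (axis y 1 - axis x (1::real))" by simp
  have "A *v (- v) = - (A *v v)" for A :: "real ^ 'v ^ 'v" and v
    by (rule linear_neg[OF matrix_vector_mul_linear])
  note neg_mult = this
  show ?thesis
    unfolding eff_resistance_def neg by (simp only: neg_mult inner_minus_left inner_minus_right minus_minus)
qed

text \<open>
  The sum ranges over unordered pairs \<open>e = {x, y}\<close>; its summand does not depend on the order in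
  which the two vertices are named.
\<close>

definition kirchhoff_index :: "'v::finite ugraph \<Rightarrow> real" where
  "kirchhoff_index G =
     (\<Sum>e | e \<subseteq> verts G \<and> card e = 2. THE r. \<exists>x y. e = {x, y} \<and> r = eff_resistance G x y)"

lemma kirchhoff_summand:
  "(THE r. \<exists>x' y'. {x, y} = {x', y'} \<and> r = eff_resistance G x' y') = eff_resistance G x y"
  by (rule the_equality) (auto simp: doubleton_eq_iff eff_resistance_commute)

end

theory Submission
  imports Defs
begin

text \<open>
  The Laplacian of \<open>K\<^sub>n - F\<close> is \<open>n I - J - \<Sum>\<^bsub>e \<in> F\<^esub> L\<^sub>e\<close>, where \<open>L\<^sub>e\<close> is the Laplacian of the single edge
  \<open>e\<close>. An isolated deleted edge contributes the eigenvector \<open>e\<^sub>a - e\<^sub>b\<close> with eigenvalue \<open>n - 2\<close>, and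
  a deleted path \<open>a - c - b\<close> contributes \<open>e\<^sub>a - e\<^sub>b\<close> and \<open>e\<^sub>a + e\<^sub>b - 2 e\<^sub>c\<close> with eigenvalues \<open>n - 1\<close> and
  \<open>n - 3\<close>; all other eigenvectors orthogonal to the constants have eigenvalue \<open>n\<close>. The Kirchhoff
  index is \<open>n\<close> times the sum of the reciprocals of the nonzero eigenvalues, so the two indices
  differ by \<open>n (1/(n-1) + 1/(n-3) - 2/(n-2))\<close>.
\<close>

section \<open>Matrices diagonal in an orthogonal family\<close>

text \<open>Interpreting both matrix products as \<open>bounded_bilinear\<close> yields all rules
  for distributing them over sums and scalars.\<close>

lemma bounded_bilinear_matrix_matrix_mult:
  "bounded_bilinear ((**) :: real^'n^'m \<Rightarrow> real^'k^'n \<Rightarrow> real^'k^'m)"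
  unfolding bilinear_conv_bounded_bilinear[symmetric] bilinear_def
  by (auto intro!: linearI simp: matrix_matrix_mult_def vec_eq_iff algebra_simps
      sum.distrib sum_distrib_left)

lemma bounded_bilinear_matrix_vector_mult:
  "bounded_bilinear ((*v) :: real^'n^'m \<Rightarrow> real^'n \<Rightarrow> real^'m)"
  unfolding bilinear_conv_bounded_bilinear[symmetric] bilinear_def
  by (auto intro!: linearI simp: matrix_vector_mult_def vec_eq_iff algebra_simps
      sum.distrib sum_distrib_left)

interpretation mm: bounded_bilinear "(**) :: real^'n^'m \<Rightarrow> real^'k^'n \<Rightarrow> real^'k^'m"
  by (rule bounded_bilinear_matrix_matrix_mult)

interpretation mv: bounded_bilinear "(*v) :: real^'n^'m \<Rightarrow> real^'n \<Rightarrow> real^'m"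
  by (rule bounded_bilinear_matrix_vector_mult)

text \<open>As \<open>x / 0 = 0\<close>, \<open>proj 0\<close> is the zero matrix.\<close>

definition proj :: "real^'n \<Rightarrow> real^'n^'n" where
  "proj v = (\<chi> x y. v $ x * v $ y / (v \<bullet> v))"

lemma proj_mult_proj:
  "proj u ** proj v = (u \<bullet> v / ((u \<bullet> u) * (v \<bullet> v))) *\<^sub>R (\<chi> x y. u $ x * v $ y)"
proof -
  have "(\<Sum>k\<in>UNIV. u $ i * u $ k / (u \<bullet> u) * (v $ k * v $ j / (v \<bullet> v)))
      = (\<Sum>k\<in>UNIV. u $ k * v $ k) * (u $ i * v $ j / ((u \<bullet> u) * (v \<bullet> v)))" for i j
    unfolding sum_distrib_right by (rule sum.cong) auto
  then show ?thesis
    by (simp add: proj_def matrix_matrix_mult_def vec_eq_iff inner_vec_def)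
qed

lemma proj_idem: "proj v ** proj v = proj v"
  by (subst proj_mult_proj) (simp add: proj_def vec_eq_iff)

lemma proj_orthogonal: "u \<bullet> v = 0 \<Longrightarrow> proj u ** proj v = 0"
  by (simp add: proj_mult_proj)

lemma proj_apply: "proj u *v v = (u \<bullet> v / (u \<bullet> u)) *\<^sub>R u"
proof -
  have "(\<Sum>k\<in>UNIV. u $ i * u $ k / (u \<bullet> u) * v $ k)
      = (\<Sum>k\<in>UNIV. u $ k * v $ k) * (u $ i / (u \<bullet> u))" for i
    unfolding sum_distrib_right by (rule sum.cong) auto
  then show ?thesis
    by (simp add: proj_def matrix_vector_mult_def vec_eq_iff inner_vec_def)
qed

lemma transpose_proj: "transpose (proj v) = proj v"
  by (simp add: transpose_def proj_def vec_eq_iff mult.commute)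

lemma trace_proj: "v \<noteq> 0 \<Longrightarrow> trace (proj v) = 1"
  by (simp add: trace_def proj_def inner_vec_def sum_divide_distrib[symmetric])
     (simp add: vec_eq_iff sum_nonneg_eq_0_iff)

lemma linear_transpose: "linear (transpose :: real^'n^'m \<Rightarrow> real^'m^'n)"
  by (rule linearI) (simp_all add: transpose_def vec_eq_iff)

lemma linear_trace: "linear (trace :: real^'n^'n \<Rightarrow> real)"
  by (rule linearI) (simp_all add: trace_def sum.distrib sum_distrib_left)

text \<open>Neither unit length nor completeness is asked for: \<open>proj\<close> normalises, and a
  single eigenvalue on the complement spares extending to an eigenbasis.\<close>

locale orthogonal_family =
  fixes I :: "'i set" and w :: "'i \<Rightarrow> real^'n"
  assumes fin: "finite I"
    and nonzero: "i \<in> I \<Longrightarrow> w i \<noteq> 0"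
    and orth: "\<lbrakk>i \<in> I; j \<in> I; i \<noteq> j\<rbrakk> \<Longrightarrow> w i \<bullet> w j = 0"
begin

text \<open>
  The matrix with eigenvectors \<open>w i\<close> to the eigenvalues \<open>\<alpha> i\<close>, and with eigenvalue \<open>a\<close> on the
  orthogonal complement of their span.
\<close>

definition spectral :: "real \<Rightarrow> ('i \<Rightarrow> real) \<Rightarrow> real^'n^'n" where
  "spectral a \<alpha> = a *\<^sub>R mat 1 + (\<Sum>i\<in>I. (\<alpha> i - a) *\<^sub>R proj (w i))"

lemma proj_sum_mult:
  "(\<Sum>i\<in>I. a i *\<^sub>R proj (w i)) ** (\<Sum>i\<in>I. b i *\<^sub>R proj (w i))
     = (\<Sum>i\<in>I. (a i * b i) *\<^sub>R proj (w i))"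
proof -
  have "(\<Sum>j\<in>I. (a i *\<^sub>R proj (w i)) ** (b j *\<^sub>R proj (w j))) = (a i * b i) *\<^sub>R proj (w i)"
    if "i \<in> I" for i
  proof -
    have "(\<Sum>j\<in>I. (a i *\<^sub>R proj (w i)) ** (b j *\<^sub>R proj (w j)))
        = (\<Sum>j\<in>I. if j = i then (a i * b i) *\<^sub>R proj (w i) else 0)"
      using that orth by (intro sum.cong)
        (auto simp: mm.scaleR_left mm.scaleR_right proj_idem proj_orthogonal)
    then show ?thesis using that fin by simp
  qed
  then show ?thesis unfolding mm.sum_left unfolding mm.sum_right by simp
qed

text \<open>Off the family both factors are scalar. On each \<open>w i\<close> the corrections
  combine through \<open>a * (\<beta> - b) + b * (\<alpha> - a) + (\<alpha> - a) * (\<beta> - b) =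
  \<alpha> * \<beta> - a * b\<close>.\<close>

lemma spectral_mult: "spectral a \<alpha> ** spectral b \<beta> = spectral (a * b) (\<lambda>i. \<alpha> i * \<beta> i)"
proof -
  have "spectral a \<alpha> ** spectral b \<beta> = (a * b) *\<^sub>R mat 1 +
      (\<Sum>i\<in>I. (a * (\<beta> i - b)) *\<^sub>R proj (w i)) + (\<Sum>i\<in>I. (b * (\<alpha> i - a)) *\<^sub>R proj (w i))
      + (\<Sum>i\<in>I. ((\<alpha> i - a) * (\<beta> i - b)) *\<^sub>R proj (w i))"
    by (simp add: spectral_def mm.add_left mm.add_right mm.scaleR_left mm.scaleR_right
        proj_sum_mult scaleR_sum_right scaleR_add_right mult.commute)
  also have "\<dots> = spectral (a * b) (\<lambda>i. \<alpha> i * \<beta> i)"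
    by (simp add: spectral_def add.assoc sum.distrib[symmetric] scaleR_add_left[symmetric])
       (simp add: algebra_simps)
  finally show ?thesis .
qed

lemma transpose_spectral: "transpose (spectral a \<alpha>) = spectral a \<alpha>"
  by (simp add: spectral_def linear_add[OF linear_transpose] linear_sum[OF linear_transpose]
      linear_cmul[OF linear_transpose] transpose_proj)

text \<open>Zero eigenvalues need no separate treatment because \<open>inverse 0 = 0\<close>.\<close>

lemma pinv_spectral: "pinv (spectral a \<alpha>) = spectral (inverse a) (\<lambda>i. inverse (\<alpha> i))"
proof (rule pinv_eq)
  have inv: "x * inverse x * x = x" "inverse x * x * inverse x = inverse x" for x :: real
    by (cases "x = 0"; simp)+
  show "is_pinv (spectral a \<alpha>) (spectral (inverse a) (\<lambda>i. inverse (\<alpha> i)))"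
    \<comment> \<open>The first two Penrose equations become \<open>inv\<close> at each eigenvalue;
      the last two hold because products of spectral matrices are spectral, hence symmetric.\<close>
    by (simp only: is_pinv_def spectral_mult transpose_spectral inv simp_thms)
qed

lemma trace_spectral:
  "trace (spectral a \<alpha>) = a * real CARD('n) + (\<Sum>i\<in>I. \<alpha> i - a)"
  by (simp add: spectral_def linear_add[OF linear_trace] linear_sum[OF linear_trace]
      linear_cmul[OF linear_trace] trace_I trace_proj nonzero)

lemma spectral_apply:
  assumes "j \<in> I"
  shows "spectral a \<alpha> *v w j = \<alpha> j *\<^sub>R w j"
proof -
  have "(\<Sum>i\<in>I. (\<alpha> i - a) *\<^sub>R (proj (w i) *v w j))
      = (\<Sum>i\<in>I. if i = j then (\<alpha> j - a) *\<^sub>R w j else 0)"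
    using assms orth nonzero by (intro sum.cong) (auto simp: proj_apply)
  then show ?thesis using assms fin
    by (simp add: spectral_def mv.add_left mv.sum_left mv.scaleR_left algebra_simps)
qed

end

section \<open>The Kirchhoff index as a trace\<close>

text \<open>Ordered pairs are grouped by their underlying set; each fibre has exactly two
  members.\<close>

lemma sum_doubletons:
  fixes h :: "'v::finite set \<Rightarrow> real"
  shows "2 * (\<Sum>e | card e = 2. h e) = (\<Sum>(x, y) | x \<noteq> y. h {x, y})"
proof -
  have "(\<Sum>(x, y) | x \<noteq> y. h {x, y})
      = (\<Sum>e | card e = 2. \<Sum>z | z \<in> {(x, y). x \<noteq> y} \<and> (case z of (x, y) \<Rightarrow> {x, y}) = e.
            case z of (x, y) \<Rightarrow> h {x, y})"
    by (rule sum.group[symmetric]) auto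
  also have "\<dots> = (\<Sum>e | card e = 2. 2 * h e)"
  proof (rule sum.cong)
    fix e :: "'v set" assume "e \<in> {e. card e = 2}"
    then obtain a b where ab: "e = {a, b}" "a \<noteq> b" by (auto simp: card_2_iff)
    then have "{z. z \<in> {(x, y). x \<noteq> y} \<and> (case z of (x, y) \<Rightarrow> {x, y}) = e} = {(a, b), (b, a)}"
      by (auto simp: doubleton_eq_iff)
    then show "(\<Sum>z | z \<in> {(x, y). x \<noteq> y} \<and> (case z of (x, y) \<Rightarrow> {x, y}) = e.
            case z of (x, y) \<Rightarrow> h {x, y}) = 2 * h e"
      using ab by (simp add: insert_commute)
  qed simp
  finally show ?thesis by (simp add: sum_distrib_left)
qed

lemma eff_resistance_entries:
  "eff_resistance G x y = (let X = pinv (laplacian G) in X$x$x + X$y$y - X$x$y - X$y$x)"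
  by (simp add: eff_resistance_def Let_def mv.diff_right matrix_vector_mult_basis
      inner_diff_left inner_diff_right inner_axis' column_def)

text \<open>\<open>1\<close> is the all-ones vector, so \<open>ker\<close> says that every row sums
  to zero. Summed over all ordered pairs, the mixed entries therefore cancel and only the diagonal
  ones remain.\<close>

lemma kirchhoff_index_trace:
  fixes G :: "'v::finite ugraph"
  assumes "verts G = UNIV" and ker: "pinv (laplacian G) *v 1 = 0"
  shows "kirchhoff_index G = real CARD('v) * trace (pinv (laplacian G))"
proof -
  define X where "X = pinv (laplacian G)"
  define h where "h e = (THE r. \<exists>x y. e = {x, y} \<and> r = eff_resistance G x y)" for e
  have h: "h {x, y} = X$x$x + X$y$y - X$x$y - X$y$x" for x y
    unfolding h_def kirchhoff_summand by (simp add: eff_resistance_entries X_def Let_def)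
  have row: "(\<Sum>y\<in>UNIV. X$x$y) = 0" for x
    using ker by (simp add: X_def vec_eq_iff matrix_vector_mult_def)
  then have col: "(\<Sum>x\<in>UNIV. \<Sum>y\<in>UNIV. X$y$x) = 0"
    by (subst sum.swap) simp
  have "2 * kirchhoff_index G = (\<Sum>(x, y) | x \<noteq> y. h {x, y})"
    unfolding kirchhoff_index_def h_def[symmetric] using assms(1) by (simp add: sum_doubletons)
  \<comment> \<open>Pairs with \<open>x = y\<close> may be added because the formula
    \<open>h\<close> gives zero for them.\<close>
  also have "\<dots> = (\<Sum>(x, y)\<in>UNIV. h {x, y})"
    using h[of x x for x] by (intro sum.mono_neutral_left) auto
  also have "\<dots> = (\<Sum>x\<in>UNIV. \<Sum>y\<in>UNIV. X$x$x + X$y$y - X$x$y - X$y$x)"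
    by (simp add: sum.cartesian_product h)
  also have "\<dots> = 2 * (real CARD('v) * trace X)"
    by (simp add: sum.distrib sum_subtractf row col trace_def sum_distrib_left)
  finally show ?thesis by (simp add: X_def)
qed

section \<open>Deleting edges from the complete graph\<close>

definition edge_laplacian :: "'v::finite set \<Rightarrow> real^'v^'v" where
  "edge_laplacian e = (\<chi> x y. if x \<in> e \<and> y \<in> e then if x = y then 1 else -1 else 0)"

lemma laplacian_eq_sum_edge_laplacian:
  assumes "\<And>e. e \<in> edges G \<Longrightarrow> card e = 2"
  shows "laplacian G = (\<Sum>e\<in>edges G. edge_laplacian e)"
proof -
  have diag: "real (degree G x) = (\<Sum>e\<in>edges G. if x \<in> e then 1 else 0)" for x
    by (simp add: degree_def sum.If_cases Int_def conj_commute)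
  \<comment> \<open>The diagonal of \<open>adjacency_matrix\<close> tests
    \<open>{x, x} = {x}\<close>, which is never an edge.\<close>
  have loop: "{x} \<notin> edges G" for x
    using assms[of "{x}"] by auto
  have off: "(\<Sum>e\<in>edges G. if x \<in> e \<and> y \<in> e then -1 else 0)
      = (if {x, y} \<in> edges G then -1 else (0::real))" if "x \<noteq> y" for x y
  proof -
    have "x \<in> e \<and> y \<in> e \<longleftrightarrow> e = {x, y}" if "e \<in> edges G" for e
      using assms[OF that] \<open>x \<noteq> y\<close> by (auto simp: card_2_iff)
    then have "(\<Sum>e\<in>edges G. if x \<in> e \<and> y \<in> e then -1 else 0)
        = (\<Sum>e\<in>edges G. if e = {x, y} then -1 else (0::real))"
      by (intro sum.cong) simp_all
    then show ?thesis by simp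
  qed
  show ?thesis
    using off by (auto simp: vec_eq_iff laplacian_def degree_matrix_def adjacency_matrix_def
        edge_laplacian_def diag loop)
qed

text \<open>Writing the all-ones matrix as a multiple of a projection brings the complete graph into
  spectral form; the factor is \<open>1 \<bullet> 1\<close>.\<close>

lemma proj_one: "real CARD('v) *\<^sub>R proj (1 :: real^'v::finite) = (\<chi> x y. 1)"
  by (simp add: vec_eq_iff proj_def inner_vec_def)

lemma laplacian_complete_graph:
  "laplacian (complete_graph (UNIV :: 'v::finite set)) = real CARD('v) *\<^sub>R (mat 1 - proj 1)"
proof -
  have "degree (complete_graph UNIV) x = CARD('v) - 1" for x :: 'v
  proof -
    have "{e \<in> edges (complete_graph UNIV). x \<in> e} = (\<lambda>y. {x, y}) ` (UNIV - {x})"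
      by (auto simp: complete_graph_def card_2_iff doubleton_eq_iff)
    moreover have "inj_on (\<lambda>y. {x, y}) (UNIV - {x})"
      by (auto simp: inj_on_def doubleton_eq_iff)
    ultimately show ?thesis by (simp add: degree_def card_image)
  qed
  moreover have "real (CARD('v) - 1) = real CARD('v) - 1"
    by (simp add: of_nat_diff Suc_leI)
  ultimately show ?thesis
    unfolding scaleR_diff_right proj_one
    by (auto simp: vec_eq_iff laplacian_def degree_matrix_def adjacency_matrix_def mat_def
        complete_graph_def card_2_iff)
qed

lemma laplacian_delete_edges_complete:
  assumes "F \<subseteq> edges (complete_graph (UNIV :: 'v::finite set))"
  shows "laplacian (delete_edges (complete_graph (UNIV :: 'v set)) F)
    = real CARD('v) *\<^sub>R (mat 1 - proj 1) - (\<Sum>e\<in>F. edge_laplacian e)"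
proof -
  let ?K = "complete_graph (UNIV :: 'v set)"
  have "laplacian (delete_edges ?K F) = (\<Sum>e\<in>edges ?K - F. edge_laplacian e)"
    by (subst laplacian_eq_sum_edge_laplacian) (auto simp: delete_edges_def complete_graph_def)
  also have "\<dots> = (\<Sum>e\<in>edges ?K. edge_laplacian e) - (\<Sum>e\<in>F. edge_laplacian e)"
    using assms by (simp add: sum_diff)
  also have "(\<Sum>e\<in>edges ?K. edge_laplacian e) = laplacian ?K"
    by (rule laplacian_eq_sum_edge_laplacian[symmetric]) (auto simp: complete_graph_def)
  finally show ?thesis by (simp add: laplacian_complete_graph)
qed

text \<open>Each vector lowers the eigenvalue n of the complete graph to \<open>n - \<mu> i\<close>.
  This changes n times the trace of the pseudoinverse by
  \<open>n / (n - \<mu> i) - 1 = \<mu> i / (n - \<mu> i)\<close>.\<close>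

lemma kirchhoff_index_delete_edges_complete:
  fixes F :: "'v::finite set set" and w :: "'i \<Rightarrow> real^'v"
  assumes F: "F \<subseteq> edges (complete_graph UNIV)"
    and "orthogonal_family I w"
    and one: "\<And>i. i \<in> I \<Longrightarrow> w i \<bullet> 1 = 0"
    and lap: "(\<Sum>e\<in>F. edge_laplacian e) = (\<Sum>i\<in>I. \<mu> i *\<^sub>R proj (w i))"
    and \<mu>: "\<And>i. i \<in> I \<Longrightarrow> \<mu> i \<noteq> real CARD('v)"
  shows "kirchhoff_index (delete_edges (complete_graph (UNIV :: 'v set)) F)
    = real CARD('v) - 1 + (\<Sum>i\<in>I. \<mu> i / (real CARD('v) - \<mu> i))"
proof -
  let ?n = "real CARD('v)"
  let ?G = "delete_edges (complete_graph (UNIV :: 'v set)) F"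
  interpret w: orthogonal_family I w by fact
  \<comment> \<open>\<open>None\<close> indexes the all-ones vector, which joins the family with
    eigenvalue 0.\<close>
  define J where "J = insert None (Some ` I)"
  define u where "u = case_option 1 w"
  define \<alpha> where "\<alpha> = case_option 0 (\<lambda>i. ?n - \<mu> i)"
  have sum_J: "sum f J = f None + (\<Sum>i\<in>I. f (Some i))" for f :: "'i option \<Rightarrow> 'b::comm_monoid_add"
    using w.fin by (simp add: J_def sum.reindex)
  interpret u: orthogonal_family J u
  proof
    show "finite J" using w.fin by (simp add: J_def)
    have "(1 :: real^'v) \<noteq> 0" by (simp add: vec_eq_iff)
    then show "u i \<noteq> 0" if "i \<in> J" for i
      using that by (auto simp: J_def u_def w.nonzero)
    have eq: "i = j" if "i \<in> I" "j \<in> I" "w i \<bullet> w j \<noteq> 0" for i j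
      using w.orth that by blast
    have one': "1 \<bullet> w i = 0" if "i \<in> I" for i
      using one[OF that] by (simp add: inner_commute)
    show "u i \<bullet> u j = 0" if "i \<in> J" "j \<in> J" "i \<noteq> j" for i j
      using that by (auto simp: J_def u_def one one' dest: eq)
  qed
  have L: "laplacian ?G = u.spectral ?n \<alpha>"
    unfolding laplacian_delete_edges_complete[OF F] lap u.spectral_def sum_J
    by (simp add: u_def \<alpha>_def sum_negf algebra_simps)
  have P: "pinv (laplacian ?G) = u.spectral (inverse ?n) (\<lambda>j. inverse (\<alpha> j))"
    by (simp add: L u.pinv_spectral)
  have "pinv (laplacian ?G) *v 1 = 0"
    using u.spectral_apply[of None "inverse ?n" "\<lambda>j. inverse (\<alpha> j)"]
    by (simp add: P J_def u_def \<alpha>_def)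
  then have "kirchhoff_index ?G = ?n * trace (pinv (laplacian ?G))"
    by (intro kirchhoff_index_trace) (auto simp: delete_edges_def complete_graph_def)
  \<comment> \<open>The \<open>None\<close> term of the trace is
    \<open>inverse 0 - inverse n = - inverse n\<close>; multiplied by n it gives the
    \<open>- 1\<close>.\<close>
  also have "\<dots> = ?n - 1 + (\<Sum>i\<in>I. ?n * (inverse (?n - \<mu> i) - inverse ?n))"
    by (simp add: P u.trace_spectral sum_J \<alpha>_def algebra_simps sum_distrib_left)
  also have "(\<Sum>i\<in>I. ?n * (inverse (?n - \<mu> i) - inverse ?n)) = (\<Sum>i\<in>I. \<mu> i / (?n - \<mu> i))"
  proof (rule sum.cong)
    fix i assume "i \<in> I"
    then show "?n * (inverse (?n - \<mu> i) - inverse ?n) = \<mu> i / (?n - \<mu> i)"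
      using \<mu>[of i] by (simp add: field_simps)
  qed simp
  finally show ?thesis .
qed

text \<open>The sign of the vector is an arbitrary choice of orientation.\<close>

definition edge_vector :: "'v::finite set \<Rightarrow> real^'v" where
  "edge_vector e = (SOME w. \<exists>a b. e = {a, b} \<and> a \<noteq> b \<and> w = axis a 1 - axis b 1)"

lemma edge_vectorE:
  assumes "card e = 2"
  obtains a b where "e = {a, b}" "a \<noteq> b" "edge_vector e = axis a 1 - axis b 1"
proof -
  have "\<exists>w. \<exists>a b. e = {a, b} \<and> a \<noteq> b \<and> w = axis a 1 - axis b (1::real)"
    using assms by (auto simp: card_2_iff)
  from someI_ex[OF this] show ?thesis
    using that unfolding edge_vector_def by blast
qed

text \<open>With z the edge vector, the edge Laplacian is the outer product of z with itself, and
  \<open>z \<bullet> z = 2\<close>.\<close>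

lemma edge_laplacian_proj:
  assumes "card e = 2"
  shows "edge_laplacian e = 2 *\<^sub>R proj (edge_vector e)"
proof -
  obtain a b where ab: "e = {a, b}" "a \<noteq> b" "edge_vector e = axis a 1 - axis b 1"
    using assms by (rule edge_vectorE)
  have "edge_vector e \<bullet> edge_vector e = 2"
    using ab by (simp add: inner_diff_left inner_diff_right inner_axis_axis)
  then show ?thesis
    using ab by (auto simp: vec_eq_iff edge_laplacian_def proj_def axis_def)
qed

text \<open>1 and 3 are the nonzero Laplacian eigenvalues of a path on three vertices with middle
  \<open>c\<close>. The two edges share \<open>c\<close>, so their own edge vectors are not
  orthogonal and must be replaced by this pair.\<close>

lemma edge_laplacian_path:
  fixes a b c :: "'v::finite"
  assumes "a \<noteq> b" "a \<noteq> c" "b \<noteq> c"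
  shows "edge_laplacian {a, c} + edge_laplacian {c, b}
    = proj (axis a 1 - axis b 1) + 3 *\<^sub>R proj (axis a 1 + axis b 1 - 2 *\<^sub>R axis c 1)"
proof -
  have "(axis a 1 - axis b 1) \<bullet> (axis a 1 - axis b (1::real)) = 2"
    "(axis a 1 + axis b 1 - 2 *\<^sub>R axis c 1) \<bullet> (axis a 1 + axis b 1 - 2 *\<^sub>R axis c (1::real)) = 6"
    using assms by (simp_all add: inner_simps inner_axis_axis)
  then show ?thesis
    using assms by (auto simp: vec_eq_iff edge_laplacian_def proj_def axis_def)
qed

lemma edge_vector_nonzero: "card e = 2 \<Longrightarrow> edge_vector e \<noteq> 0"
  by (elim edge_vectorE) (auto simp: vec_eq_iff axis_def)

lemma edge_vector_inner_one: "card e = 2 \<Longrightarrow> edge_vector e \<bullet> 1 = 0"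
  by (elim edge_vectorE) (auto simp: inner_simps inner_axis')

text \<open>Orthogonality is read off from disjoint supports, both between matching edges and
  between a matching edge and the path.\<close>

lemma edge_vector_orthogonal:
  assumes "card e = 2" and "\<And>x. x \<in> e \<Longrightarrow> v $ x = 0"
  shows "edge_vector e \<bullet> v = 0"
  using assms by (elim edge_vectorE) (auto simp: inner_simps inner_axis')

lemma edge_vector_outside: "card e = 2 \<Longrightarrow> x \<notin> e \<Longrightarrow> edge_vector e $ x = 0"
  by (elim edge_vectorE) (auto simp: axis_def)

section \<open>Kirchhoff indices for the two deletion patterns\<close>

lemma kirchhoff_index_delete_matching:
  fixes M :: "'v::finite set set"
  assumes M: "matching_in (complete_graph UNIV) M" and n: "CARD('v) > 2"
  shows "kirchhoff_index (delete_edges (complete_graph (UNIV :: 'v set)) M)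
    = real CARD('v) - 1 + real (card M) * (2 / (real CARD('v) - 2))"
proof -
  have sub: "M \<subseteq> edges (complete_graph UNIV)" and dis: "disjoint M"
    using M by (auto simp: matching_in_def)
  have card: "card e = 2" if "e \<in> M" for e
    using sub that by (auto simp: complete_graph_def)
  have "orthogonal_family M edge_vector"
  proof
    fix e f assume "e \<in> M" "f \<in> M" "e \<noteq> f"
    then show "edge_vector e \<bullet> edge_vector f = 0"
      using dis card by (intro edge_vector_orthogonal edge_vector_outside)
        (auto simp: disjoint_def)
  qed (auto simp: card edge_vector_nonzero)
  \<comment> \<open>Every \<open>\<mu>\<close> is 2, which differs from the number of vertices by
    \<open>n\<close>.\<close>
  then show ?thesis
    using n by (subst kirchhoff_index_delete_edges_complete[OF sub, where \<mu> = "\<lambda>_. 2"])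
      (auto simp: card edge_vector_inner_one edge_laplacian_proj)
qed

lemma kirchhoff_index_delete_path_matching:
  fixes M :: "'v::finite set set"
  assumes M: "matching_in (complete_graph UNIV) M" and n: "CARD('v) > 3"
    and abc: "a \<noteq> b" "a \<noteq> c" "b \<noteq> c"
    and avoid: "a \<notin> \<Union>M" "b \<notin> \<Union>M" "c \<notin> \<Union>M"
  shows "kirchhoff_index
      (delete_edges (complete_graph (UNIV :: 'v set)) (insert {a, c} (insert {c, b} M)))
    = real CARD('v) - 1 + 1 / (real CARD('v) - 1) + 3 / (real CARD('v) - 3)
      + real (card M) * (2 / (real CARD('v) - 2))"
proof -
  have sub: "M \<subseteq> edges (complete_graph UNIV)" and dis: "disjoint M"
    using M by (auto simp: matching_in_def)
  have card: "card e = 2" if "e \<in> M" for e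
    using sub that by (auto simp: complete_graph_def)
  have sub': "insert {a, c} (insert {c, b} M) \<subseteq> edges (complete_graph UNIV)"
    using sub abc by (auto simp: complete_graph_def)
  have notin: "{a, c} \<notin> M" "{c, b} \<notin> M" "{a, c} \<noteq> {c, b}"
    using avoid abc by (auto simp: doubleton_eq_iff)
  define u v :: "real^'v"
    where "u = axis a 1 - axis b 1" and "v = axis a 1 + axis b 1 - 2 *\<^sub>R axis c 1"
  \<comment> \<open>The deleted edges themselves serve as index set; \<open>{a, c}\<close> and
    \<open>{c, b}\<close> are mere names for the path eigenvectors \<open>u\<close> and
    \<open>v\<close>.\<close>
  define w where "w e = (if e = {a, c} then u else if e = {c, b} then v else edge_vector e)" for e
  define \<mu> :: "'v set \<Rightarrow> real" where
    "\<mu> e = (if e = {a, c} then 1 else if e = {c, b} then 3 else 2)" for e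
  have wM: "w e = edge_vector e" "\<mu> e = 2" if "e \<in> M" for e
    using notin that by (auto simp: w_def \<mu>_def)
  have w12: "w {a, c} = u" "w {c, b} = v" "\<mu> {a, c} = 1" "\<mu> {c, b} = 3"
    using notin by (auto simp: w_def \<mu>_def)
  \<comment> \<open>Both vectors have entry 1 at \<open>a\<close>, hence are nonzero.\<close>
  have uv: "u \<bullet> v = 0" "u \<noteq> 0" "v \<noteq> 0" "u \<bullet> 1 = 0" "v \<bullet> 1 = 0"
    using abc by (auto simp: u_def v_def inner_simps inner_axis' inner_axis_axis)
      (auto simp: vec_eq_iff axis_def dest: spec[of _ a])
  have uM: "edge_vector e \<bullet> u = 0" "edge_vector e \<bullet> v = 0" if "e \<in> M" for e
    using that avoid card by (auto intro!: edge_vector_orthogonal simp: u_def v_def axis_def)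
  let ?F = "insert {a, c} (insert {c, b} M)"
  have sumF: "sum f ?F = f {a, c} + (f {c, b} + sum f M)"
    for f :: "'v set \<Rightarrow> 'b::comm_monoid_add"
    using notin by simp
  have "orthogonal_family ?F w"
  proof
    fix e f assume *: "e \<in> ?F" "f \<in> ?F" "e \<noteq> f"
    have "edge_vector e \<bullet> edge_vector f = 0" if "e \<in> M" "f \<in> M"
      using that * dis card by (intro edge_vector_orthogonal edge_vector_outside)
        (auto simp: disjoint_def)
    then show "w e \<bullet> w f = 0"
      using * uv uM by (auto simp: wM w12 inner_commute)
  qed (use uv in \<open>auto simp: card wM w12 edge_vector_nonzero\<close>)
  moreover have "(\<Sum>e\<in>?F. edge_laplacian e) = (\<Sum>e\<in>?F. \<mu> e *\<^sub>R proj (w e))"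
    unfolding sumF by (simp add: edge_laplacian_path[OF abc] add.assoc[symmetric] w12 u_def v_def
      edge_laplacian_proj card wM)
  ultimately have "kirchhoff_index (delete_edges (complete_graph (UNIV :: 'v set)) ?F)
      = real CARD('v) - 1 + (\<Sum>e\<in>?F. \<mu> e / (real CARD('v) - \<mu> e))"
    using n uv by (intro kirchhoff_index_delete_edges_complete[OF sub'])
      (auto simp: w12 wM card edge_vector_inner_one)
  then show ?thesis
    unfolding sumF by (simp add: w12 wM)
qed

section \<open>The shape of the deleted edge set\<close>

text \<open>The edges of the model graph are pulled back along the inverse \<open>g\<close> of the
  isomorphism: the path supplies \<open>a\<close>, \<open>c\<close>, \<open>b\<close>, and the
  copies of the single edge form \<open>M\<close>.\<close>

lemma path_matching_decomposition:
  assumes F: "F \<subseteq> edges (complete_graph UNIV)"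
    and iso: "graph_iso (deletion_graph F)
        (disjoint_union (path_graph 3) (copies m (complete_graph {..<2::nat})))"
  obtains a b c M where "a \<noteq> b" "a \<noteq> c" "b \<noteq> c" "F = insert {a, c} (insert {c, b} M)"
    "matching_in (complete_graph UNIV) M" "card M = m"
    "a \<notin> \<Union>M" "b \<notin> \<Union>M" "c \<notin> \<Union>M"
proof -
  let ?H = "disjoint_union (path_graph 3) (copies m (complete_graph {..<2::nat}))"
  obtain f where bij: "bij_betw f (\<Union>F) (verts ?H)"
    and f: "\<forall>x\<in>\<Union>F. \<forall>y\<in>\<Union>F. {x, y} \<in> F \<longleftrightarrow> {f x, f y} \<in> edges ?H"
    using iso unfolding graph_iso_def deletion_graph_def ugraph.simps by (elim exE conjE)
  define g where "g = inv_into (\<Union>F) f"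
  have bijg: "bij_betw g (verts ?H) (\<Union>F)"
    unfolding g_def by (rule bij_betw_inv_into[OF bij])
  have fg: "f (g z) = z" "g z \<in> \<Union>F" if "z \<in> verts ?H" for z
    using that bij bijg bij_betw_inv_into_right[OF bij] by (auto simp: g_def dest: bij_betwE)
  have gf: "g (f x) = x" if "x \<in> \<Union>F" for x
    using that bij_betw_inv_into_left[OF bij] by (simp add: g_def)
  have ginj: "g z = g z' \<longleftrightarrow> z = z'" if "z \<in> verts ?H" "z' \<in> verts ?H" for z z'
    using that fg by metis
  have verts: "verts ?H = Inl ` {..<3} \<union> Inr ` ({..<m} \<times> {..<2})"
    by (simp add: disjoint_union_def path_graph_def copies_def complete_graph_def)
  have K2: "edges (copies m (complete_graph {..<2::nat})) = (\<lambda>i. {(i, 0), (i, 1)}) ` {..<m}"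
  proof -
    have "{..<2::nat} = {0, 1}" by auto
    then have "{e. e \<subseteq> {..<2::nat} \<and> card e = 2} = {{0, 1}}" by (auto simp: card_2_iff)
    then show ?thesis by (auto simp: copies_def complete_graph_def)
  qed
  have P3: "edges (path_graph 3) = {{0, 1}, {1, 2}}"
  proof -
    have "{{i, Suc i} |i. Suc i < 3} = (\<lambda>i. {i, Suc i}) ` {i. Suc i < 3}" by blast
    moreover have "{i. Suc i < 3} = {0, 1}" by auto
    ultimately show ?thesis by (simp add: path_graph_def numeral_2_eq_2)
  qed
  define k :: "nat \<Rightarrow> (nat + nat \<times> nat) set" where "k i = {Inr (i, 0), Inr (i, 1)}" for i
  have edges: "edges ?H = insert {Inl 0, Inl 1} (insert {Inl 1, Inl 2} (k ` {..<m}))"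
    by (simp add: disjoint_union_def P3 K2 image_image k_def)
  \<comment> \<open>The isomorphism speaks about pairs only, so each edge on either side is first
    written as a pair; the two inclusions use the two directions of the equivalence.\<close>
  have F_eq: "F = (\<lambda>e. g ` e) ` edges ?H"
  proof (intro equalityI subsetI)
    fix e assume e: "e \<in> F"
    then obtain x y where xy: "e = {x, y}"
      using F by (auto simp: complete_graph_def card_2_iff)
    then have "x \<in> \<Union>F" "y \<in> \<Union>F" using e by auto
    then have "{f x, f y} \<in> edges ?H" "e = g ` {f x, f y}"
      using f e gf xy by auto
    then show "e \<in> (\<lambda>e. g ` e) ` edges ?H" by blast
  next
    fix e assume "e \<in> (\<lambda>e. g ` e) ` edges ?H"
    then obtain d where d: "d \<in> edges ?H" "e = g ` d" by blast
    then obtain z z' where z: "d = {z, z'}" "z \<in> verts ?H" "z' \<in> verts ?H"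
      by (auto simp: edges verts k_def)
    then show "e \<in> F"
      using d bspec[OF bspec[OF f fg(2)[OF z(2)]] fg(2)[OF z(3)]] fg(1) by simp
  qed
  define M where "M = (\<lambda>i. g ` k i) ` {..<m}"
  have kv: "k i \<subseteq> verts ?H" if "i < m" for i
    using that by (auto simp: verts k_def)
  have l: "Inl 0 \<in> verts ?H" "Inl 1 \<in> verts ?H" "Inl 2 \<in> verts ?H"
    by (auto simp: verts)
  have inj: "inj_on g (verts ?H)" using bijg by (rule bij_betw_imp_inj_on)
  have kdis: "g ` k i \<inter> g ` k j = {}" if "i < m" "j < m" "i \<noteq> j" for i j
  proof -
    have "g ` k i \<inter> g ` k j = g ` (k i \<inter> k j)"
      using inj_on_image_Int[OF inj] kv that by auto
    then show ?thesis using that by (auto simp: k_def)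
  qed
  have F_M: "F = insert {g (Inl 0), g (Inl 1)} (insert {g (Inl 1), g (Inl 2)} M)"
    by (subst F_eq) (simp add: edges M_def image_image)
  have "matching_in (complete_graph UNIV) M"
    using F F_M kdis by (auto simp: matching_in_def disjoint_def M_def)
  moreover have "card M = m"
  proof -
    \<comment> \<open>Disjoint nonempty sets are distinct.\<close>
    have "inj_on (\<lambda>i. g ` k i) {..<m}"
    proof (rule inj_onI, rule ccontr)
      fix i j assume "i \<in> {..<m}" "j \<in> {..<m}" "g ` k i = g ` k j" "i \<noteq> j"
      then have "g ` k i = {}" using kdis[of i j] by auto
      then show False by (simp add: k_def)
    qed
    then show ?thesis by (simp add: M_def card_image)
  qed
  moreover have "g (Inl q) \<notin> \<Union>M" if "Inl q \<in> verts ?H" for q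
  proof
    assume "g (Inl q) \<in> \<Union>M"
    then obtain i z where "i < m" "z \<in> k i" "g (Inl q) = g z" by (auto simp: M_def)
    then show False using ginj[OF that, of z] kv[of i] by (auto simp: k_def)
  qed
  \<comment> \<open>The middle vertex of the path is 1, so \<open>c\<close> is
    \<open>g (Inl 1)\<close>.\<close>
  ultimately show ?thesis
    using that[of "g (Inl 0)" "g (Inl 2)" "g (Inl 1)" M] l F_M
    by (simp add: ginj)
qed

section \<open>Comparison of the two indices\<close>

theorem corollary6p1:
  fixes n p :: nat and F0 M :: "'v::finite set set"
  assumes "CARD('v) = n"
    and "p \<ge> 2" and "n \<ge> max 4 (2 * p)"
    and "F0 \<subseteq> edges (complete_graph (UNIV :: 'v set))"
    and "graph_iso (deletion_graph F0)
           (disjoint_union (path_graph 3) (copies (p - 2) (complete_graph {..<2::nat})))"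
    and "matching_in (complete_graph (UNIV :: 'v set)) M" and "card M = p"
  shows "kirchhoff_index (delete_edges (complete_graph (UNIV :: 'v set)) F0)
           - kirchhoff_index (delete_edges (complete_graph (UNIV :: 'v set)) M)
         = 2 * real n / ((real n - 1) * (real n - 2) * (real n - 3))"
proof -
  have n: "real n \<ge> 4" using assms(3) by simp
  obtain a b c N where N: "a \<noteq> b" "a \<noteq> c" "b \<noteq> c" "F0 = insert {a, c} (insert {c, b} N)"
    "matching_in (complete_graph UNIV) N" "card N = p - 2"
    "a \<notin> \<Union>N" "b \<notin> \<Union>N" "c \<notin> \<Union>N"
    by (rule path_matching_decomposition[OF assms(4,5)])
  \<comment> \<open>Since \<open>p \<ge> 2\<close>, the natural-number difference
    \<open>p - 2\<close> casts to \<open>real p - 2\<close>.\<close>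
  have "kirchhoff_index (delete_edges (complete_graph UNIV) F0)
      = real n - 1 + 1 / (real n - 1) + 3 / (real n - 3) + (real p - 2) * (2 / (real n - 2))"
    using kirchhoff_index_delete_path_matching[OF N(5) _ N(1-3,7-9)] N(4,6) assms(1-3) by simp
  moreover have "kirchhoff_index (delete_edges (complete_graph UNIV) M)
      = real n - 1 + real p * (2 / (real n - 2))"
    using kirchhoff_index_delete_matching[OF assms(6)] assms(1,3,7) by simp
  \<comment> \<open>The terms in \<open>p\<close> cancel; the two matching edges replaced by the
    path leave \<open>4 / (n - 2)\<close>.\<close>
  ultimately have "kirchhoff_index (delete_edges (complete_graph UNIV) F0)
      - kirchhoff_index (delete_edges (complete_graph UNIV) M)
      = 1 / (real n - 1) + 3 / (real n - 3) - 4 / (real n - 2)"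
    by (simp add: left_diff_distrib diff_divide_distrib)
  \<comment> \<open>Over the common denominator, nonzero as \<open>n \<ge> 4\<close>, the numerator
    is \<open>(n-2)*(n-3) + 3*(n-1)*(n-2) - 4*(n-1)*(n-3) = 2*n\<close>.\<close>
  also have "\<dots> = 2 * real n / ((real n - 1) * (real n - 2) * (real n - 3))"
    using n by (simp add: divide_simps) algebra
  finally show ?thesis .
qed

end
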